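(* Let $q\neq 9$ be an odd prime power, or let $q=2$. Then the Paige loop $M^*(q)$ is generated (as a loop) by three elements of order three.
   Context: For a prime power $q$ let $F=GF(q)$. The Paige loop $M^*(q)$ consists of all vector matrices $$M=\begin{pmatrix} a & \alpha\\ \beta & b\end{pmatrix},\qquad a,b\in F,\ \alpha,\beta\in F^3,\qquad \det M=ab-\alpha\cdot\beta=1,$$ where $M$ is identified with $-M$ (the matrix with all entries negated). The multiplication is the Zorn multiplication $$\begin{pmatrix} a & \alpha\\ \beta & b\end{pmatrix}\begin{pmatrix} c & \gamma\\ \delta & d\end{pmatrix}=\begin{pmatrix} ac+\alpha\cdot\delta & a\gamma+d\alpha-\beta\times\delta\\ c\beta+b\delta+\alpha\times\gamma & \beta\cdot\gamma+bd\end{pmatrix},$$ where $\cdot$ and $\times$ denote the standard dot product and cross product on $F^3$. With this multiplication $M^*(q)$ is a (non-associative, finite, simple) Moufang loop. Its neutral element is the class of the vector matrix with $a=b=1$, $\alpha=\beta=0$. Moufang loops are diassociative (any two elements generate a subgroup), so powers and orders of elements are well defined. *)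

theory Defs
  imports "HOL-Analysis.Cartesian_Space" "HOL-Algebra.Group"
begin

locale loop =
  fixes L (structure)
  assumes m_closed: "\<lbrakk>x \<in> carrier L; y \<in> carrier L\<rbrakk> \<Longrightarrow> x \<otimes> y \<in> carrier L"
    and one_closed: "\<one> \<in> carrier L"
    and l_one: "x \<in> carrier L \<Longrightarrow> \<one> \<otimes> x = x"
    and r_one: "x \<in> carrier L \<Longrightarrow> x \<otimes> \<one> = x"
    and l_div: "\<lbrakk>a \<in> carrier L; b \<in> carrier L\<rbrakk> \<Longrightarrow> \<exists>!x. x \<in> carrier L \<and> a \<otimes> x = b"
    and r_div: "\<lbrakk>a \<in> carrier L; b \<in> carrier L\<rbrakk> \<Longrightarrow> \<exists>!y. y \<in> carrier L \<and> y \<otimes> a = b"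

definition subloop :: "'a set \<Rightarrow> ('a, 'b) monoid_scheme \<Rightarrow> bool" where
  "subloop H L \<longleftrightarrow> H \<subseteq> carrier L \<and> loop (L\<lparr>carrier := H\<rparr>)"

definition loop_generate :: "('a, 'b) monoid_scheme \<Rightarrow> 'a set \<Rightarrow> 'a set" where
  "loop_generate L X = \<Inter>{H. subloop H L \<and> X \<subseteq> H}"

text \<open>The constant \<open>group.ord\<close> is only specified for groups. The powers used here are bracketed
  to the left, \<open>x [^] 3 = (x \<otimes> x) \<otimes> x\<close>; in a diassociative loop the bracketing is irrelevant.
  The value \<open>0\<close> stands for infinite order.\<close>

definition loop_ord :: "('a, 'b) monoid_scheme \<Rightarrow> 'a \<Rightarrow> nat" where
  "loop_ord L x =
     (if \<exists>n::nat>0. x [^]\<^bsub>L\<^esub> n = \<one>\<^bsub>L\<^esub>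
      then LEAST n::nat. n > 0 \<and> x [^]\<^bsub>L\<^esub> n = \<one>\<^bsub>L\<^esub> else 0)"

text \<open>The library's inner product and cross product are restricted to real vectors.\<close>

definition dot :: "'a::comm_ring_1 ^ 3 \<Rightarrow> 'a ^ 3 \<Rightarrow> 'a" where
  "dot u v = (\<Sum>i\<in>UNIV. u $ i * v $ i)"

definition cross :: "'a::comm_ring_1 ^ 3 \<Rightarrow> 'a ^ 3 \<Rightarrow> 'a ^ 3" where
  "cross u v = vector [u$2 * v$3 - u$3 * v$2,
                       u$3 * v$1 - u$1 * v$3,
                       u$1 * v$2 - u$2 * v$1]"

text \<open>\<open>VMat a \<alpha> \<beta> b\<close> has first row \<open>(a, \<alpha>)\<close> and second row \<open>(\<beta>, b)\<close>.\<close>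

datatype 'a vmat = VMat 'a "'a ^ 3" "'a ^ 3" 'a

fun vm_det :: "'a::comm_ring_1 vmat \<Rightarrow> 'a" where
  "vm_det (VMat a \<alpha> \<beta> b) = a * b - dot \<alpha> \<beta>"

fun vm_neg :: "'a::comm_ring_1 vmat \<Rightarrow> 'a vmat" where
  "vm_neg (VMat a \<alpha> \<beta> b) = VMat (- a) (- \<alpha>) (- \<beta>) (- b)"

fun vm_mult :: "'a::comm_ring_1 vmat \<Rightarrow> 'a vmat \<Rightarrow> 'a vmat" where
  "vm_mult (VMat a \<alpha> \<beta> b) (VMat c \<gamma> \<delta> d) =
     VMat (a * c + dot \<alpha> \<delta>)
          (a *s \<gamma> + d *s \<alpha> - cross \<beta> \<delta>)
          (c *s \<beta> + b *s \<delta> + cross \<alpha> \<gamma>)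
          (dot \<beta> \<gamma> + b * d)"

definition vm_one :: "'a::comm_ring_1 vmat" where
  "vm_one = VMat 1 0 0 1"

definition vm_class :: "'a::comm_ring_1 vmat \<Rightarrow> 'a vmat set" where
  "vm_class M = {M, vm_neg M}"

text \<open>The type variable plays the role of the field: for \<open>'a :: {field, finite}\<close> with
  \<open>CARD('a) = q\<close> this is the Paige loop over \<open>GF(q)\<close>. Its elements are the classes
  \<open>{M, - M}\<close>, multiplied elementwise; see \<open>paige_mult_class\<close> and \<open>loop_paige\<close>.\<close>

definition paige_loop :: "'a::field vmat set monoid" where
  "paige_loop =
     \<lparr>carrier = vm_class ` {M. vm_det M = 1},
      mult = (\<lambda>A B. {vm_mult M N | M N. M \<in> A \<and> N \<in> B}),
      one = vm_class vm_one\<rparr>"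

lemmas vm_simps = dot_def cross_def vec_eq_iff sum_3 forall_3 vector_3

fun vm_conj :: "'a::comm_ring_1 vmat \<Rightarrow> 'a vmat" where
  "vm_conj (VMat a \<alpha> \<beta> b) = VMat b (- \<alpha>) (- \<beta>) a"

lemma vm_neg_neg [simp]: "vm_neg (vm_neg M) = M"
  by (cases M) simp

lemma vm_det_neg [simp]: "vm_det (vm_neg M) = vm_det M"
  by (cases M) (simp add: vm_simps)

lemma vm_det_conj [simp]: "vm_det (vm_conj M) = vm_det M"
  by (cases M) (simp add: vm_simps)

lemma vm_conj_conj [simp]: "vm_conj (vm_conj M) = M"
  by (cases M) simp

lemma vm_mult_neg_left [simp]: "vm_mult (vm_neg M) N = vm_neg (vm_mult M N)"
  by (cases M; cases N) (simp add: vm_simps algebra_simps)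

lemma vm_mult_neg_right [simp]: "vm_mult M (vm_neg N) = vm_neg (vm_mult M N)"
  by (cases M; cases N) (simp add: vm_simps algebra_simps)

lemma vm_one_mult [simp]: "vm_mult vm_one M = M"
  by (cases M) (simp add: vm_one_def vm_simps)

lemma vm_mult_one [simp]: "vm_mult M vm_one = M"
  by (cases M) (simp add: vm_one_def vm_simps)

lemma vm_det_one [simp]: "vm_det vm_one = 1"
  by (simp add: vm_one_def vm_simps)

lemma vm_det_mult: "vm_det (vm_mult M N) = vm_det M * vm_det N"
  by (cases M; cases N) (simp add: vm_simps algebra_simps)

lemma vm_conj_mult_cancel:
  assumes "vm_det M = 1"
  shows "vm_mult (vm_conj M) (vm_mult M N) = N"
proof -
  obtain a \<alpha> \<beta> b where M: "M = VMat a \<alpha> \<beta> b" by (cases M)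
  obtain c \<gamma> \<delta> d where N: "N = VMat c \<gamma> \<delta> d" by (cases N)
  have *: "a * b = 1 + (\<alpha>$1 * \<beta>$1 + \<alpha>$2 * \<beta>$2 + \<alpha>$3 * \<beta>$3)"
    using assms by (simp add: M vm_simps algebra_simps)
  have **: "a * (b * x) = (1 + (\<alpha>$1 * \<beta>$1 + \<alpha>$2 * \<beta>$2 + \<alpha>$3 * \<beta>$3)) * x" for x
    by (simp add: * flip: mult.assoc)
  show ?thesis
    by (simp add: M N vm_simps) (simp add: algebra_simps **)
qed

lemma vm_mult_conj_cancel:
  assumes "vm_det M = 1"
  shows "vm_mult (vm_mult N M) (vm_conj M) = N"
proof -
  obtain a \<alpha> \<beta> b where M: "M = VMat a \<alpha> \<beta> b" by (cases M)
  obtain c \<gamma> \<delta> d where N: "N = VMat c \<gamma> \<delta> d" by (cases N)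
  have *: "a * b = 1 + (\<alpha>$1 * \<beta>$1 + \<alpha>$2 * \<beta>$2 + \<alpha>$3 * \<beta>$3)"
    using assms by (simp add: M vm_simps algebra_simps)
  have **: "a * (b * x) = (1 + (\<alpha>$1 * \<beta>$1 + \<alpha>$2 * \<beta>$2 + \<alpha>$3 * \<beta>$3)) * x" for x
    by (simp add: * flip: mult.assoc)
  show ?thesis
    by (simp add: M N vm_simps) (simp add: algebra_simps **)
qed

lemma vm_class_neg [simp]: "vm_class (vm_neg M) = vm_class M"
  by (auto simp: vm_class_def)

lemma vm_class_eq_iff: "vm_class M = vm_class N \<longleftrightarrow> M = N \<or> M = vm_neg N"
  by (auto simp: vm_class_def doubleton_eq_iff)

lemma paige_mult_class:
  "vm_class M \<otimes>\<^bsub>paige_loop\<^esub> vm_class N = vm_class (vm_mult M N)"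
proof -
  have "vm_class M \<otimes>\<^bsub>paige_loop\<^esub> vm_class N =
        (\<lambda>(P, Q). vm_mult P Q) ` ({M, vm_neg M} \<times> {N, vm_neg N})"
    unfolding paige_loop_def vm_class_def
    by (auto simp del: vm_mult_neg_left vm_mult_neg_right)
  then show ?thesis
    by (auto simp: vm_class_def)
qed

lemma paige_carrier: "carrier paige_loop = vm_class ` {M. vm_det M = 1}"
  by (simp add: paige_loop_def)

lemma paige_one: "\<one>\<^bsub>paige_loop\<^esub> = vm_class vm_one"
  by (simp add: paige_loop_def)

theorem loop_paige: "loop (paige_loop :: 'a::field vmat set monoid)"
proof
  fix A B :: "'a vmat set"
  assume "A \<in> carrier paige_loop" "B \<in> carrier paige_loop"
  then obtain M N where M: "A = vm_class M" "vm_det M = 1" and N: "B = vm_class N" "vm_det N = 1"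
    by (auto simp: paige_carrier)
  show "A \<otimes>\<^bsub>paige_loop\<^esub> B \<in> carrier paige_loop"
    using M N by (auto simp: paige_mult_class paige_carrier vm_det_mult)
  show "\<exists>!X. X \<in> carrier paige_loop \<and> A \<otimes>\<^bsub>paige_loop\<^esub> X = B"
  proof (rule ex1I)
    show "vm_class (vm_mult (vm_conj M) N) \<in> carrier paige_loop \<and>
          A \<otimes>\<^bsub>paige_loop\<^esub> vm_class (vm_mult (vm_conj M) N) = B"
      using M N vm_conj_mult_cancel[of "vm_conj M" N]
      by (auto simp: paige_mult_class paige_carrier vm_det_mult)
    fix X assume X: "X \<in> carrier paige_loop \<and> A \<otimes>\<^bsub>paige_loop\<^esub> X = B"
    then obtain P where P: "X = vm_class P" "vm_det P = 1" by (auto simp: paige_carrier)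
    with X M N have "vm_mult M P = N \<or> vm_mult M P = vm_neg N"
      by (simp add: paige_mult_class vm_class_eq_iff)
    then show "X = vm_class (vm_mult (vm_conj M) N)"
      using vm_conj_mult_cancel[of M P] M P by (auto simp: vm_class_eq_iff)
  qed
  show "\<exists>!Y. Y \<in> carrier paige_loop \<and> Y \<otimes>\<^bsub>paige_loop\<^esub> A = B"
  proof (rule ex1I)
    show "vm_class (vm_mult N (vm_conj M)) \<in> carrier paige_loop \<and>
          vm_class (vm_mult N (vm_conj M)) \<otimes>\<^bsub>paige_loop\<^esub> A = B"
      using M N vm_mult_conj_cancel[of "vm_conj M" N]
      by (auto simp: paige_mult_class paige_carrier vm_det_mult)
    fix Y assume Y: "Y \<in> carrier paige_loop \<and> Y \<otimes>\<^bsub>paige_loop\<^esub> A = B"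
    then obtain P where P: "Y = vm_class P" "vm_det P = 1" by (auto simp: paige_carrier)
    with Y M N have "vm_mult P M = N \<or> vm_mult P M = vm_neg N"
      by (simp add: paige_mult_class vm_class_eq_iff)
    then show "Y = vm_class (vm_mult N (vm_conj M))"
      using vm_mult_conj_cancel[of M P] M P by (auto simp: vm_class_eq_iff)
  qed
qed (auto simp: paige_carrier paige_one paige_mult_class)

end

theory Submission
  imports Defs "HOL-Algebra.Multiplicative_Group"
begin

text \<open>Write \<open>e\<^sub>i\<close> for the unit vectors. The vector matrices with both off-diagonal entries in the
  line of \<open>e\<^sub>1\<close> multiply like \<open>2 \<times> 2\<close> matrices, so those of determinant one form a copy \<open>S\<close> of
  \<open>SL\<^sub>2(F)\<close>, whose transvections are \<open>upper (axis 1 s)\<close> and \<open>lower (axis 1 s)\<close>. A non-scalar element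
  of determinant one has order three in the Paige loop as soon as its trace is one, because then
  \<open>M\<^sup>2 - M + 1 = 0\<close> and \<open>M\<^sup>3 = - 1\<close>. The proof chooses three such elements for which \<open>S\<close> and an element
  outside the subalgebra spanned by \<open>S\<close> can be recovered by short products.

  For odd \<open>q > 3\<close> let \<open>\<omega>\<close> generate the multiplicative group of \<open>F\<close>. Two elements \<open>x\<close> and \<open>y\<close> of trace one
  have product \<open>diag(\<omega>, 1/\<omega>)\<close> (\<open>diagonal_factor\<close>), so the diagonal torus \<open>T\<close> of \<open>S\<close> is generated. The
  third element \<open>z\<close> lies in \<open>S\<close> and, acting on the projective line, moves one of the two fixed points of
  \<open>T\<close> to the other. Hence \<open>T\<close> and its conjugate by \<open>z\<close> share a fixed point, and a product of an element
  of each is a transvection. Conjugating it by \<open>T\<close> multiplies its parameter by any square; since every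
  element of \<open>F\<close> is a difference of two squares, all of \<open>S\<close> arises, without any appeal to the
  classification of subgroups of \<open>SL\<^sub>2(F)\<close>. The element \<open>x\<close> is chosen so that multiplying it by suitable
  elements of \<open>S\<close> on both sides gives \<open>w = VMat 1 e\<^sub>2 (- e\<^sub>2) 0\<close> (\<open>all_if_torus\<close>).

  Conjugation by \<open>w\<close> carries the transvections along \<open>e\<^sub>1\<close>, up to factors in \<open>S\<close>, to those along
  \<open>e\<^sub>3\<close>, and commutators of the two kinds give those along \<open>e\<^sub>2\<close> (\<open>all_if_first_axis\<close>). The
  transvections along the three axes generate everything, by clearing the entries of a vector matrix one after the other
  (\<open>all_if_elementary\<close>).

  For \<open>q = 3\<close> the torus is too small, but the two basic transvections of \<open>S\<close> already have order three
  and, together with \<open>w\<close>, serve as generators. For \<open>q = 2\<close> the three elements \<open>VMat 1 e\<^sub>i e\<^sub>i 0\<close> yield all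
  six transvections through explicit words. Subloops are studied through their preimages among
  vector matrices, which are closed under products and inverses (\<open>vm_closed\<close>).\<close>

section \<open>Subloops, seen on vector matrices\<close>

text \<open>For a matrix of determinant one \<open>vm_conj\<close> is the inverse, so these are the sets closed under
  multiplication and inversion. Working in them avoids both the sign classes and the division
  axioms of a loop.\<close>

locale vm_closed =
  fixes K :: "'a::field vmat set"
  assumes mult: "\<lbrakk>M \<in> K; N \<in> K\<rbrakk> \<Longrightarrow> vm_mult M N \<in> K"
    and conj: "M \<in> K \<Longrightarrow> vm_conj M \<in> K"

text \<open>The solution \<open>X\<close> of \<open>[M] X = 1\<close> that the subloop provides can only be the class of \<open>vm_conj M\<close>, since
  \<open>vm_conj M\<close> cancels \<open>M\<close> from the left.\<close>

lemma subloop_vm_closed: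
  assumes "subloop H (paige_loop :: 'a::field vmat set monoid)"
  shows "vm_closed {M. vm_det M = 1 \<and> vm_class M \<in> H}"
proof
  let ?L = "paige_loop :: 'a vmat set monoid"
  have sub: "H \<subseteq> carrier ?L" and lp: "loop (?L\<lparr>carrier := H\<rparr>)"
    using assms by (auto simp: subloop_def)
  have m: "A \<otimes>\<^bsub>?L\<^esub> B \<in> H" if "A \<in> H" "B \<in> H" for A B
    using loop.m_closed[OF lp] that by simp
  have one: "vm_class vm_one \<in> H"
    using loop.one_closed[OF lp] by (simp add: paige_one)
  fix M :: "'a vmat"
  assume M: "M \<in> {M. vm_det M = 1 \<and> vm_class M \<in> H}"
  show "vm_mult M N \<in> {M. vm_det M = 1 \<and> vm_class M \<in> H}"
    if "N \<in> {M. vm_det M = 1 \<and> vm_class M \<in> H}" for N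
    using m[of "vm_class M" "vm_class N"] M that by (simp add: paige_mult_class vm_det_mult)
  obtain X where X: "X \<in> H" "vm_class M \<otimes>\<^bsub>?L\<^esub> X = vm_class vm_one"
    using loop.l_div[OF lp, of "vm_class M" "vm_class vm_one"] M one by auto
  then obtain P where P: "X = vm_class P" "vm_det P = 1"
    using sub by (auto simp: paige_carrier)
  with X have "vm_mult M P = vm_one \<or> vm_mult M P = vm_neg vm_one"
    by (simp add: paige_mult_class vm_class_eq_iff)
  then have "P = vm_conj M \<or> P = vm_neg (vm_conj M)"
    using vm_conj_mult_cancel[of M P] M by auto
  then show "vm_conj M \<in> {M. vm_det M = 1 \<and> vm_class M \<in> H}"
    using X P M by auto
qed

lemma paige_generate_eqI:
  fixes S :: "'a::field vmat set"
  assumes det: "\<And>M. M \<in> S \<Longrightarrow> vm_det M = 1"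
    and gen: "\<And>K M. \<lbrakk>vm_closed K; S \<subseteq> K; vm_det M = 1\<rbrakk> \<Longrightarrow> M \<in> K"
  shows "loop_generate paige_loop (vm_class ` S) = carrier paige_loop"
proof
  let ?L = "paige_loop :: 'a vmat set monoid"
  have "subloop (carrier ?L) ?L"
    using loop_paige by (simp add: subloop_def)
  then show "loop_generate ?L (vm_class ` S) \<subseteq> carrier ?L"
    using det by (auto simp: loop_generate_def paige_carrier)
  have "carrier ?L \<subseteq> H" if H: "subloop H ?L" "vm_class ` S \<subseteq> H" for H
  proof -
    have "M \<in> {M. vm_det M = 1 \<and> vm_class M \<in> H}" if "vm_det M = 1" for M
      by (rule gen[OF subloop_vm_closed[OF H(1)] _ that]) (use H det in auto)
    then show ?thesis by (auto simp: paige_carrier)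
  qed
  then show "carrier ?L \<subseteq> loop_generate ?L (vm_class ` S)"
    by (auto simp: loop_generate_def)
qed

section \<open>Elements of order three\<close>

lemma loop_ord_eq_3I:
  assumes "x [^]\<^bsub>L\<^esub> (1::nat) \<noteq> \<one>\<^bsub>L\<^esub>" "x [^]\<^bsub>L\<^esub> (2::nat) \<noteq> \<one>\<^bsub>L\<^esub>"
    and p3: "x [^]\<^bsub>L\<^esub> (3::nat) = \<one>\<^bsub>L\<^esub>"
  shows "loop_ord L x = 3"
proof -
  have "(LEAST n::nat. n > 0 \<and> x [^]\<^bsub>L\<^esub> n = \<one>\<^bsub>L\<^esub>) = 3"
  proof (rule Least_equality)
    show "3 \<le> n" if n: "n > 0 \<and> x [^]\<^bsub>L\<^esub> n = \<one>\<^bsub>L\<^esub>" for n :: nat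
    proof (rule ccontr)
      assume "\<not> 3 \<le> n"
      with n have "n = 1 \<or> n = 2" by linarith
      with n assms(1,2) show False by blast
    qed
  qed (simp add: p3)
  moreover have "\<exists>n::nat>0. x [^]\<^bsub>L\<^esub> n = \<one>\<^bsub>L\<^esub>"
    by (rule exI[of _ 3]) (simp add: p3)
  ultimately show ?thesis by (simp only: loop_ord_def if_True)
qed

text \<open>A vector matrix is a root of its characteristic polynomial, so trace one and determinant one give
  \<open>M\<^sup>2 = M - 1\<close> and \<open>M\<^sup>3 = - 1\<close>, which is trivial modulo sign. Neither \<open>M\<close> nor \<open>M - 1\<close> is \<open>\<plusminus> 1\<close>
  because both have the same off-diagonal entries, not all of them zero.\<close>

lemma loop_ord_3:
  fixes a b :: "'a::field"
  assumes det: "a * b - dot \<alpha> \<beta> = 1" and tr: "a + b = 1" and nz: "\<alpha> \<noteq> 0 \<or> \<beta> \<noteq> 0"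
  shows "loop_ord paige_loop (vm_class (VMat a \<alpha> \<beta> b)) = 3"
proof -
  let ?L = "paige_loop :: 'a vmat set monoid"
  let ?M = "VMat a \<alpha> \<beta> b"
  have b: "b = 1 - a" using tr by (simp add: algebra_simps)
  have dot: "dot \<alpha> \<beta> = a * b - 1" "dot \<beta> \<alpha> = a * b - 1"
    using det by (simp_all add: dot_def mult.commute algebra_simps)
  have cross: "cross v v = 0" for v :: "'a ^ 3"
    by (simp add: vm_simps)
  have comb: "x *s v + y *s v = (x + y) *s v" for x y and v :: "'a ^ 3"
    by (simp add: vector_sadd_rdistrib)
  have M2: "vm_mult ?M ?M = VMat (a - 1) \<alpha> \<beta> (b - 1)"
    by (simp add: dot cross comb b) (simp add: algebra_simps)
  have M3: "vm_mult (vm_mult ?M ?M) ?M = vm_neg vm_one"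
    unfolding M2 by (simp add: dot cross comb b vm_one_def) (simp add: algebra_simps)
  have pow0: "vm_class ?M [^]\<^bsub>?L\<^esub> (0::nat) = vm_class vm_one"
    by (simp add: nat_pow_def paige_one)
  have powS: "vm_class ?M [^]\<^bsub>?L\<^esub> Suc n = vm_class ?M [^]\<^bsub>?L\<^esub> n \<otimes>\<^bsub>?L\<^esub> vm_class ?M" for n
    by (simp add: nat_pow_def)
  have p1: "vm_class ?M [^]\<^bsub>?L\<^esub> (1::nat) = vm_class ?M"
    unfolding One_nat_def powS pow0 paige_mult_class vm_one_mult ..
  have p2: "vm_class ?M [^]\<^bsub>?L\<^esub> (2::nat) = vm_class (vm_mult ?M ?M)"
    unfolding numeral_2_eq_2 powS pow0 paige_mult_class vm_one_mult ..
  have p3: "vm_class ?M [^]\<^bsub>?L\<^esub> (3::nat) = \<one>\<^bsub>?L\<^esub>"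
    unfolding numeral_3_eq_3 powS pow0 paige_mult_class vm_one_mult M3 paige_one vm_class_neg ..
  have n1: "vm_class ?M [^]\<^bsub>?L\<^esub> (1::nat) \<noteq> \<one>\<^bsub>?L\<^esub>"
    unfolding p1 paige_one using nz by (auto simp: vm_class_eq_iff vm_one_def)
  have n2: "vm_class ?M [^]\<^bsub>?L\<^esub> (2::nat) \<noteq> \<one>\<^bsub>?L\<^esub>"
    unfolding p2 M2 paige_one using nz by (auto simp: vm_class_eq_iff vm_one_def)
  show ?thesis by (rule loop_ord_eq_3I[OF n1 n2 p3])
qed

section \<open>Elementary vector matrices\<close>

definition upper :: "'a::field ^ 3 \<Rightarrow> 'a vmat" where
  "upper v = VMat 1 v 0 1"

definition lower :: "'a::field ^ 3 \<Rightarrow> 'a vmat" where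
  "lower v = VMat 1 0 v 1"

lemmas elem_simps = upper_def lower_def axis_def vm_simps algebra_simps

lemma dot_axis: "dot v (axis i c) = v $ i * c"
  by (simp add: dot_def axis_def if_distrib cong: if_cong)

lemma vec_3_eta: "vector [v$1, v$2, v$3] = (v :: 'a::zero ^ 3)"
  by (simp add: vec_eq_iff forall_3 vector_3)

context vm_closed
begin

lemma multI: "\<lbrakk>P \<in> K; Q \<in> K; vm_mult P Q = R\<rbrakk> \<Longrightarrow> R \<in> K"
  using mult by blast

text \<open>If one diagonal entry of a vector matrix of determinant one equals 1, the matrix is a product of an
  upper and a lower unitriangular one. In general, a nonzero off-diagonal entry allows one further
  unitriangular factor to bring a diagonal entry to 1. A diagonal matrix first receives a nonzero
  off-diagonal entry in the same way.\<close>

lemma all_if_elementary: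
  assumes up: "\<And>i s. upper (axis i s) \<in> K" and lo: "\<And>i s. lower (axis i s) \<in> K"
    and M: "vm_det M = 1"
  shows "M \<in> K"
proof -
  \<comment> \<open>\<open>upper u\<close> times \<open>upper v\<close> is \<open>upper (u + v)\<close> up to a lower entry \<open>cross u v\<close>. This entry is
      orthogonal to \<open>u + v\<close>, so a lower factor cancels it without disturbing the rest, and that factor
      involves fewer axes than the vector being built.\<close>
  have up2: "upper (vector [s, t, 0]) \<in> K" for s t
    by (rule multI[OF mult[OF up[of 1 s] up[of 2 t]] lo[of 3 "- (s * t)"]])
       (simp add: elem_simps)
  have lo2: "lower (vector [s, t, 0]) \<in> K" for s t
    by (rule multI[OF mult[OF lo[of 1 s] lo[of 2 t]] up[of 3 "s * t"]])
       (simp add: elem_simps)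
  have "upper (vector [s, t, r]) \<in> K" for s t r
    by (rule multI[OF mult[OF up2[of s t] up[of 3 r]] lo2[of "- (t * r)" "s * r"]])
       (simp add: elem_simps)
  from this[of "v$1" "v$2" "v$3" for v :: "'a ^ 3"] have U: "upper v \<in> K" for v
    by (simp add: vec_3_eta)
  have "lower (vector [s, t, r]) \<in> K" for s t r
    by (rule multI[OF mult[OF lo2[of s t] lo[of 3 r]] up2[of "t * r" "- (s * r)"]])
       (simp add: elem_simps)
  from this[of "v$1" "v$2" "v$3" for v :: "'a ^ 3"] have L: "lower v \<in> K" for v
    by (simp add: vec_3_eta)
  have one2: "VMat a \<alpha> \<beta> 1 \<in> K" if "vm_det (VMat a \<alpha> \<beta> 1) = 1" for a \<alpha> \<beta>
    by (rule multI[OF U[of \<alpha>] L[of \<beta>]]) (use that in \<open>simp add: elem_simps\<close>)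
  have one1: "VMat 1 \<alpha> \<beta> b \<in> K" if "vm_det (VMat 1 \<alpha> \<beta> b) = 1" for b \<alpha> \<beta>
    by (rule multI[OF L[of \<beta>] U[of \<alpha>]]) (use that in \<open>simp add: elem_simps\<close>)
  have Ucan: "N \<in> K" if "vm_mult N (upper v) \<in> K" for N v
    by (rule multI[OF that conj[OF U[of v]]], rule vm_mult_conj_cancel) (simp add: elem_simps)
  have Lcan: "N \<in> K" if "vm_mult N (lower v) \<in> K" for N v
    by (rule multI[OF that conj[OF L[of v]]], rule vm_mult_conj_cancel) (simp add: elem_simps)
  have detU: "vm_det (upper v) = 1" and detL: "vm_det (lower v) = 1" for v :: "'a ^ 3"
    by (simp_all add: elem_simps)
  have top: "VMat a \<alpha> \<beta> b \<in> K" if d: "vm_det (VMat a \<alpha> \<beta> b) = 1" and "\<alpha> \<noteq> 0" for a b \<alpha> \<beta>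
  proof -
    obtain i where i: "\<alpha> $ i \<noteq> 0" using \<open>\<alpha> \<noteq> 0\<close> by (auto simp: vec_eq_iff)
    let ?v = "axis i ((1 - a) / \<alpha> $ i)"
    have "vm_det (vm_mult (VMat a \<alpha> \<beta> b) (lower ?v)) = 1"
      by (simp add: vm_det_mult d detL del: vm_det.simps)
    moreover have "\<exists>\<alpha>' \<beta>' b'. vm_mult (VMat a \<alpha> \<beta> b) (lower ?v) = VMat 1 \<alpha>' \<beta>' b'"
      using i by (simp add: lower_def dot_axis)
    ultimately show ?thesis using one1 Lcan by metis
  qed
  have bot: "VMat a \<alpha> \<beta> b \<in> K" if d: "vm_det (VMat a \<alpha> \<beta> b) = 1" and "\<beta> \<noteq> 0" for a b \<alpha> \<beta>
  proof -
    obtain i where i: "\<beta> $ i \<noteq> 0" using \<open>\<beta> \<noteq> 0\<close> by (auto simp: vec_eq_iff)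
    let ?v = "axis i ((1 - b) / \<beta> $ i)"
    have "vm_det (vm_mult (VMat a \<alpha> \<beta> b) (upper ?v)) = 1"
      by (simp add: vm_det_mult d detU del: vm_det.simps)
    moreover have "\<exists>a' \<alpha>' \<beta>'. vm_mult (VMat a \<alpha> \<beta> b) (upper ?v) = VMat a' \<alpha>' \<beta>' 1"
      using i by (simp add: upper_def dot_axis)
    ultimately show ?thesis using one2 Ucan by metis
  qed
  obtain a \<alpha> \<beta> b where MM: "M = VMat a \<alpha> \<beta> b" by (cases M)
  show ?thesis
  proof (cases "\<alpha> = 0 \<and> \<beta> = 0")
    case True
    then have "a \<noteq> 0" using M by (auto simp: MM vm_simps)
    have "vm_det (vm_mult M (upper (axis 1 1))) = 1"
      by (simp add: vm_det_mult M detU)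
    moreover have "vm_mult M (upper (axis 1 1)) = VMat a (axis 1 a) 0 b"
      using True by (simp add: MM elem_simps)
    moreover have "axis (1::3) a \<noteq> 0"
      using \<open>a \<noteq> 0\<close> by (simp add: axis_eq_0_iff)
    ultimately show ?thesis using top Ucan by metis
  next
    case False
    then show ?thesis using top bot M MM by blast
  qed
qed

text \<open>Conjugating \<open>upper (axis 1 s)\<close> by \<open>w\<close> leaves the algebra of the first axis: the result is its inverse
  changed by a nilpotent term along the third axis, which the multiplication by \<open>upper (axis 1 s)\<close> then
  isolates. For \<open>lower (axis 1 s)\<close> conjugation already gives \<open>upper (axis 3 s)\<close>. The commutator of
  transvections with parameters \<open>s\<close> and \<open>t\<close> along the axes 1 and 3 has parameter \<open>\<plusminus> 2 s t\<close> along axis 2,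
  hence the assumption on the characteristic.\<close>

lemma all_if_first_axis:
  assumes char: "(2::'a) \<noteq> 0"
    and up: "\<And>s. upper (axis 1 s) \<in> K" and lo: "\<And>s. lower (axis 1 s) \<in> K"
    and w: "VMat 1 (axis 2 1) (axis 2 (-1)) 0 \<in> K"
    and M: "vm_det M = 1"
  shows "M \<in> K"
proof -
  have lo3: "lower (axis 3 s) \<in> K" for s
    by (rule multI[OF mult[OF conj[OF w] mult[OF up[of "s"] w]] up[of "s"]])
       (simp add: elem_simps)
  have up3: "upper (axis 3 s) \<in> K" for s
    by (rule multI[OF conj[OF w] mult[OF lo[of "s"] w]])
       (simp add: elem_simps)
  have half: "s / 2 + s / 2 = s" for s :: 'a
    using char by (simp add: field_simps)
  have lo2: "lower (axis 2 s) \<in> K" for s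
    by (rule multI[OF mult[OF mult[OF up[of "-s/2"] up3[of 1]] up[of "s/2"]] up3[of "- 1"]])
       (use half[of s] in \<open>simp add: elem_simps\<close>)
  have up2: "upper (axis 2 s) \<in> K" for s
    by (rule multI[OF mult[OF mult[OF lo[of "s/2"] lo3[of 1]] lo[of "-s/2"]] lo3[of "- 1"]])
       (use half[of s] in \<open>simp add: elem_simps\<close>)
  have U: "upper (axis i s) \<in> K" for i s
    using up up2 up3 exhaust_3[of i] by auto
  have L: "lower (axis i s) \<in> K" for i s
    using lo lo2 lo3 exhaust_3[of i] by auto
  show ?thesis by (rule all_if_elementary[OF U L M])
qed

end

section \<open>Finite fields\<close>

text \<open>The multiplicative group of a finite field is cyclic; the proof carries this fact over from
  carrier-based fields.\<close>

lemma ex_primitive_element: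
  "\<exists>\<omega>::'a::{field,finite}. \<omega> \<noteq> 0 \<and> (\<forall>t. t \<noteq> 0 \<longrightarrow> (\<exists>k::nat. t = \<omega> ^ k))"
proof -
  let ?R = "\<lparr>carrier = UNIV, mult = (*), one = 1, zero = 0, add = (+)\<rparr> :: 'a ring"
  have "abelian_group ?R"
    by (rule abelian_groupI) (auto simp: algebra_simps intro: exI[of _ "- x" for x :: 'a])
  moreover have "comm_monoid ?R"
    by (rule comm_monoidI) (auto simp: algebra_simps)
  ultimately have "cring ?R"
    by (rule cringI) (auto simp: algebra_simps)
  then have R: "Ring.field ?R"
  proof (rule cring.cring_fieldI2)
    show "\<exists>b\<in>carrier ?R. a \<otimes>\<^bsub>?R\<^esub> b = \<one>\<^bsub>?R\<^esub>" if "a \<noteq> \<zero>\<^bsub>?R\<^esub>" for a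
      using that by (intro bexI[of _ "inverse a"]) auto
  qed auto
  have pow: "a [^]\<^bsub>?R\<^esub> (n::nat) = a ^ n" for a n
    by (induction n) (simp_all add: nat_pow_def mult_of_def mult.commute)
  have "\<exists>a\<in>carrier (mult_of ?R).
      carrier (mult_of ?R) = {a [^]\<^bsub>?R\<^esub> i | i::nat. i \<in> UNIV}"
    by (rule field.finite_field_mult_group_has_gen[OF R]) simp
  then obtain a where "a \<in> carrier (mult_of ?R)"
    and "carrier (mult_of ?R) = {a [^]\<^bsub>?R\<^esub> i | i::nat. i \<in> UNIV}"
    by blast
  then have a: "a \<noteq> 0" "UNIV - {0} = {a ^ i | i::nat. i \<in> UNIV}"
    unfolding pow by simp_all
  then have "\<exists>k::nat. t = a ^ k" if "t \<noteq> 0" for t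
    using that by (auto simp: set_eq_iff)
  with a show ?thesis by blast
qed

text \<open>Translation by 1 permutes \<open>F\<close>, so comparing the sums over \<open>F\<close> before and after shows that the
  cardinality of \<open>F\<close> vanishes in \<open>F\<close>.\<close>

lemma two_neq_0_if_odd_card:
  assumes "odd CARD('a::field)"
  shows "(2::'a) \<noteq> 0"
proof
  assume 2: "(2::'a) = 0"
  have "(\<Sum>x\<in>UNIV. x :: 'a) = (\<Sum>x\<in>UNIV. x + 1)"
    by (rule sum.reindex_bij_witness[of _ "\<lambda>x. x + 1" "\<lambda>x. x - 1"]) auto
  also have "\<dots> = (\<Sum>x\<in>UNIV. x) + of_nat CARD('a)"
    by (simp add: sum.distrib)
  finally have "of_nat CARD('a) = (0::'a)"
    by simp
  moreover obtain k where "CARD('a) = 2 * k + 1"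
    using assms by (elim oddE)
  ultimately show False
    using 2 by simp
qed

lemma field_card_2:
  assumes card: "CARD('a::field) = 2"
  shows "s = 0 \<or> s = (1::'a)" "- x = (x::'a)" "x + x = (0::'a)" "(2::'a) = 0"
proof -
  have "card {0, 1 :: 'a} = 2"
    by simp
  then have "{0, 1 :: 'a} = UNIV"
    using card by (metis card_eq_UNIV_imp_eq_UNIV card.infinite zero_neq_numeral)
  then show cases: "s = 0 \<or> s = 1" for s :: 'a
    by blast
  then have "(1 + 1 :: 'a) = 0"
    by (metis add_cancel_right_left one_neq_zero)
  then show two: "x + x = 0" for x :: 'a
    by (metis distrib_left mult.right_neutral mult_zero_right)
  then show "- x = x" "(2::'a) = 0" for x :: 'a
    using two[of 1] by (simp_all add: neg_eq_iff_add_eq_0)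
qed

lemma field_card_3:
  assumes card: "CARD('a::field) = 3"
  shows "(2::'a) = - 1" "s = 0 \<or> s = 1 \<or> s = (- 1 :: 'a)"
proof -
  have two: "(2::'a) \<noteq> 0"
    using card by (intro two_neq_0_if_odd_card) simp
  then have "(1::'a) \<noteq> - 1"
    by (metis add.right_inverse one_add_one)
  then have "card {0, 1, - 1 :: 'a} = 3"
    by (auto simp: card_insert_if)
  then have "{0, 1, - 1 :: 'a} = UNIV"
    using card by (metis card_eq_UNIV_imp_eq_UNIV card.infinite zero_neq_numeral)
  then show cases: "s = 0 \<or> s = 1 \<or> s = - 1" for s :: 'a
    by blast
  have "(2::'a) \<noteq> 1"
    by (metis add_cancel_right_left one_add_one one_neq_zero)
  with cases[of 2] two show "(2::'a) = - 1"
    by blast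
qed

section \<open>Generating triples\<close>

context vm_closed
begin
text \<open>The matrix \<open>z\<close> moves one fixed point of the torus to the other. The entries of the
  third matrix come from solving for a matrix with diagonal \<open>(a, 1 - a)\<close> of the form \<open>g w h\<close>, where \<open>g = lower (axis 1 (1 - a))\<close> and \<open>h = upper (axis 1 (1 - a)) z\<close>
  lie in the copy of \<open>SL\<^sub>2(F)\<close> along the first axis.\<close>

lemma all_if_torus:
  assumes char: "(2::'a) \<noteq> 0"
    and \<omega>: "\<omega> \<noteq> 0" "\<omega>\<^sup>2 \<noteq> 1" and prim: "\<And>t. t \<noteq> 0 \<Longrightarrow> \<exists>k::nat. t = \<omega> ^ k"
    and d: "VMat \<omega> 0 0 (1 / \<omega>) \<in> K"
    and z: "VMat 1 (axis 1 1) (axis 1 (-1)) 0 \<in> K"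
    and x: "VMat a (vector [1, 0, 1]) (vector [a * (1 - a), 1 - 2 * a, - 1]) (1 - a) \<in> K"
    and M: "vm_det M = 1"
  shows "M \<in> K"
proof -
  have one: "VMat 1 0 0 1 \<in> K"
    by (rule multI[OF conj[OF z] z]) (simp add: elem_simps)
  have torus: "VMat t 0 0 (1 / t) \<in> K" if "t \<noteq> 0" for t
  proof -
    have "VMat (\<omega> ^ k) 0 0 (1 / \<omega> ^ k) \<in> K" for k
    proof (induction k)
      case 0
      show ?case using one by simp
    next
      case (Suc k)
      show ?case
        by (rule multI[OF d Suc]) (simp add: elem_simps)
    qed
    then show ?thesis using prim[OF that] by blast
  qed
  define c where "c = 1 / \<omega>\<^sup>2 - 1"
  have "c \<noteq> 0" using \<omega> by (simp add: c_def)
  \<comment> \<open>\<open>z d z\<inverse>\<close> is upper triangular with diagonal \<open>(1/\<omega>, \<omega>)\<close>, so multiplying by \<open>d\<close> makes it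
      unitriangular.\<close>
  have "upper (axis 1 c) \<in> K"
    by (rule multI[OF mult[OF mult[OF z d] conj[OF z]] d])
       (use \<omega> in \<open>simp add: elem_simps c_def power2_eq_square\<close>)
  then have sq: "upper (axis 1 (c * t\<^sup>2)) \<in> K" if "t \<noteq> 0" for t
    by (rule multI[OF mult[OF torus[OF that]] conj[OF torus[OF that]]])
       (use that in \<open>simp add: elem_simps power2_eq_square\<close>)
  have zero: "axis (1::3) (0::'a) = 0"
    by (simp add: axis_eq_0_iff)
  have sq': "upper (axis 1 (c * t\<^sup>2)) \<in> K" for t
    using sq[of t] one by (cases "t = 0") (auto simp: upper_def zero)
  have diff: "upper (axis 1 (c * (t\<^sup>2 - r\<^sup>2))) \<in> K" for t r
    by (rule multI[OF sq'[of t] conj[OF sq'[of r]]]) (simp add: elem_simps)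
  have up: "upper (axis 1 s) \<in> K" for s
  proof -
    have 4: "(4::'a) \<noteq> 0"
      using char by (metis mult_eq_0_iff mult_2 numeral_Bit0)
    have "((x + 1) / 2)\<^sup>2 - ((x - 1) / 2)\<^sup>2 = x" for x :: 'a
    proof -
      have "((x + 1) / 2)\<^sup>2 - ((x - 1) / 2)\<^sup>2 = (4 * x) / 4"
        unfolding power_divide diff_divide_distrib[symmetric]
        by (simp add: power2_eq_square algebra_simps)
      then show ?thesis using 4 by simp
    qed
    then have "c * (((s / c + 1) / 2)\<^sup>2 - ((s / c - 1) / 2)\<^sup>2) = s"
      using \<open>c \<noteq> 0\<close> by simp
    with diff show ?thesis by metis
  qed
  have lo: "lower (axis 1 s) \<in> K" for s
    by (rule multI[OF conj[OF z] mult[OF up[of "- s"] z]]) (simp add: elem_simps)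
  have w: "VMat 1 (axis 2 1) (axis 2 (-1)) 0 \<in> K"
    by (rule multI[OF conj[OF lo[of "1 - a"]] mult[OF x conj[OF mult[OF up[of "1 - a"] z]]]])
       (simp add: elem_simps)
  show ?thesis by (rule all_if_first_axis[OF char up lo w M])
qed
end

text \<open>Solving \<open>x y = diag(\<omega>, 1/\<omega>)\<close> for \<open>y\<close> gives a matrix of trace \<open>b \<omega> + a/\<omega>\<close>, and this trace equals the
  trace \<open>a + b = 1\<close> of \<open>x\<close> for \<open>a = \<omega> b\<close>, in which case \<open>y\<close> even has the diagonal of \<open>x\<close>.\<close>

lemma diagonal_factor:
  fixes \<omega> :: "'a::field"
  assumes \<omega>: "\<omega> \<noteq> 0" and a: "a = \<omega> * b" and tr: "a + b = 1"
    and dot: "dot \<alpha> \<beta> = a * b - 1"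
  shows "vm_mult (VMat a \<alpha> \<beta> b) (VMat a (- (1 / \<omega>) *s \<alpha>) (- \<omega> *s \<beta>) b) = VMat \<omega> 0 0 (1 / \<omega>)"
proof -
  have scal: "dot u (c *s v) = c * dot u v" "cross u (c *s u) = 0" for u v :: "'a ^ 3" and c
    by (simp_all add: vm_simps algebra_simps)
  have dot': "dot \<beta> \<alpha> = a * b - 1"
    using dot by (simp add: dot_def mult.commute)
  have "a * a + - \<omega> * (a * b - 1) = \<omega>" "- (1 / \<omega>) * (a * b - 1) + b * b = 1 / \<omega>"
    using \<omega> by (simp_all add: a field_simps)
  moreover have "a *s (- (1 / \<omega>) *s \<alpha>) + b *s \<alpha> = 0" "a *s \<beta> + b *s (- \<omega> *s \<beta>) = 0"
    using \<omega> by (simp_all add: a vec_eq_iff)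
  ultimately show ?thesis
    by (simp only: vm_mult.simps scal dot dot' diff_0_right add_0_right)
qed

context vm_closed
begin

lemma all_if_card_3:
  assumes card: "CARD('a) = 3"
    and u: "upper (axis 1 1) \<in> K" and l: "lower (axis 1 1) \<in> K"
    and w: "VMat 1 (axis 2 1) (axis 2 (-1)) 0 \<in> K"
    and M: "vm_det M = 1"
  shows "M \<in> K"
proof -
  have two: "(2::'a) \<noteq> 0"
    using card by (intro two_neq_0_if_odd_card) simp
  have "upper (axis 1 0) \<in> K" "lower (axis 1 0) \<in> K"
    by (rule multI[OF conj[OF u] u], simp add: elem_simps)
       (rule multI[OF conj[OF u] u], simp add: elem_simps)
  moreover have "upper (axis 1 (-1)) \<in> K"
    by (rule multI[OF conj[OF u] multI[OF conj[OF u] u refl]]) (simp add: elem_simps)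
  moreover have "lower (axis 1 (-1)) \<in> K"
    by (rule multI[OF conj[OF l] multI[OF conj[OF l] l refl]]) (simp add: elem_simps)
  ultimately show ?thesis
    using field_card_3(2)[OF card] u l by (intro all_if_first_axis[OF two _ _ w M]) metis+
qed

text \<open>In characteristic two the commutators used in \<open>all_if_first_axis\<close> vanish. The words below express
  the transvections along axis 1; cyclic permutation of the axes gives the others.\<close>

lemma all_if_card_2:
  assumes card: "CARD('a) = 2"
    and z: "\<And>i. VMat 1 (axis i 1) (axis i 1) 0 \<in> K"
    and M: "vm_det M = 1"
  shows "M \<in> K"
proof -
  note char2 = field_card_2(2-4)[OF card]
  have one: "VMat 1 0 0 1 \<in> K"
    by (rule multI[OF conj[OF z[of 1]] z[of 1]]) (simp add: elem_simps char2)
  have "upper (axis 1 1) \<in> K"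
    by (rule multI[OF z[of 2] mult[OF z[of 2] mult[OF z[of 3] z[of 1]]]])
       (simp add: elem_simps char2)
  moreover have "upper (axis 2 1) \<in> K"
    by (rule multI[OF z[of 3] mult[OF z[of 3] mult[OF z[of 1] z[of 2]]]])
       (simp add: elem_simps char2)
  moreover have "upper (axis 3 1) \<in> K"
    by (rule multI[OF z[of 1] mult[OF z[of 1] mult[OF z[of 2] z[of 3]]]])
       (simp add: elem_simps char2)
  ultimately have u: "upper (axis i 1) \<in> K" for i
    using exhaust_3[of i] by auto
  have "lower (axis 1 1) \<in> K"
    by (rule multI[OF mult[OF z[of 1] z[of 2]] mult[OF z[of 3] z[of 3]]])
       (simp add: elem_simps char2)
  moreover have "lower (axis 2 1) \<in> K"
    by (rule multI[OF mult[OF z[of 2] z[of 3]] mult[OF z[of 1] z[of 1]]])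
       (simp add: elem_simps char2)
  moreover have "lower (axis 3 1) \<in> K"
    by (rule multI[OF mult[OF z[of 3] z[of 1]] mult[OF z[of 2] z[of 2]]])
       (simp add: elem_simps char2)
  ultimately have l: "lower (axis i 1) \<in> K" for i
    using exhaust_3[of i] by auto
  have zero: "axis i (0::'a) = 0" for i :: 3
    by (simp add: axis_eq_0_iff)
  have "upper (axis i s) \<in> K" "lower (axis i s) \<in> K" for i s
    using field_card_2(1)[OF card, of s] u[of i] l[of i] one by (auto simp: upper_def lower_def zero)
  then show ?thesis
    by (rule all_if_elementary[OF _ _ M])
qed

end

section \<open>The Paige loop\<close>

lemma generating_tripleI:
  fixes x y z :: "'a::field vmat"
  assumes det: "vm_det x = 1" "vm_det y = 1" "vm_det z = 1"
    and ord: "loop_ord paige_loop (vm_class x) = 3" "loop_ord paige_loop (vm_class y) = 3"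
      "loop_ord paige_loop (vm_class z) = 3"
    and ne: "vm_class x \<noteq> vm_class y" "vm_class x \<noteq> vm_class z" "vm_class y \<noteq> vm_class z"
    and gen: "\<And>K M. \<lbrakk>vm_closed K; x \<in> K; y \<in> K; z \<in> K; vm_det M = 1\<rbrakk> \<Longrightarrow> M \<in> K"
  shows "\<exists>X. X \<subseteq> carrier paige_loop \<and> card X = 3 \<and>
           (\<forall>A\<in>X. loop_ord paige_loop A = 3) \<and> loop_generate paige_loop X = carrier (paige_loop :: 'a vmat set monoid)"
proof (intro exI conjI)
  let ?X = "vm_class ` {x, y, z}"
  show "?X \<subseteq> carrier paige_loop"
    using det by (auto simp: paige_carrier)
  show "card ?X = 3"
    using ne by (simp add: card_insert_if)
  show "\<forall>A\<in>?X. loop_ord paige_loop A = 3"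
    using ord by simp
  show "loop_generate paige_loop ?X = carrier paige_loop"
    by (rule paige_generate_eqI) (use det gen in auto)
qed

theorem proposition1:
  fixes q :: nat and L :: "'a::{field, finite} vmat set monoid"
  assumes "CARD('a) = q"
    and "odd q \<and> q \<noteq> 9 \<or> q = 2"
    and "L = paige_loop"
  shows "\<exists>X. X \<subseteq> carrier L \<and> card X = 3 \<and>
           (\<forall>x\<in>X. loop_ord L x = 3) \<and> loop_generate L X = carrier L"
proof -
  have axis: "dot (axis i s) (axis i t) = s * t" for i and s t :: 'a
    by (simp add: dot_axis axis_nth)
  have axis0: "axis i s = 0 \<longleftrightarrow> s = 0" for i :: 3 and s :: 'a
    by (simp add: axis_eq_0_iff)
  have dot0: "dot v 0 = 0" "dot 0 v = 0" for v :: "'a ^ 3"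
    by (simp_all add: dot_def)
  consider (two) "q = 2" | (three) "q = 3" | (large) "odd q" "q \<noteq> 1" "q \<noteq> 3" | (one) "q = 1"
    using assms(2) by blast
  then show ?thesis
  proof cases
    case one
    have "card {0, 1 :: 'a} \<le> CARD('a)"
      by (intro card_mono) auto
    with one assms(1) show ?thesis by simp
  next
    case two
    then have card: "CARD('a) = 2" using assms(1) by simp
    let ?z = "\<lambda>i. VMat (1::'a) (axis i 1) (axis i 1) 0 :: 'a vmat"
    have char2: "- x = x" for x :: 'a
      using field_card_2(2)[OF card] .
    have det: "vm_det (?z i) = 1" for i
      by (simp add: axis char2)
    have ord: "loop_ord paige_loop (vm_class (?z i)) = 3" for i
      by (rule loop_ord_3) (use char2[of 1] in \<open>simp_all add: axis axis0\<close>)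
    have negv: "- v = v" for v :: "'a ^ 3"
      by (simp add: vec_eq_iff char2)
    have ne: "vm_class (?z i) \<noteq> vm_class (?z j)" if "i \<noteq> j" for i j
      using that by (auto simp: vm_class_eq_iff axis_eq_axis negv)
    show ?thesis unfolding assms(3)
    proof (rule generating_tripleI[of "?z 1" "?z 2" "?z 3"])
      fix K :: "'a vmat set" and M :: "'a vmat"
      assume K: "vm_closed K" "?z 1 \<in> K" "?z 2 \<in> K" "?z 3 \<in> K" and M: "vm_det M = 1"
      have "?z i \<in> K" for i
        using K exhaust_3[of i] by auto
      then show "M \<in> K"
        by (rule vm_closed.all_if_card_2[OF K(1) card _ M])
    qed (use det ord ne in auto)
  next
    case three
    then have card: "CARD('a) = 3" using assms(1) by simp
    have m1: "(2::'a) = - 1"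
      by (rule field_card_3(1)[OF card])
    let ?w = "VMat 1 (axis 2 1) (axis 2 (-1)) 0 :: 'a vmat"
    have ordU: "loop_ord paige_loop (vm_class (upper (axis 1 1) :: 'a vmat)) = 3"
    proof -
      \<comment> \<open>The trace of a transvection is \<open>2 = - 1\<close>; its negative represents the same class and has
          trace one.\<close>
      have "loop_ord paige_loop (vm_class (vm_neg (upper (axis 1 1)) :: 'a vmat)) = 3"
        unfolding upper_def vm_neg.simps
        by (rule loop_ord_3) (use m1 in \<open>simp_all add: axis0 dot0\<close>)
      then show ?thesis by simp
    qed
    have ordL: "loop_ord paige_loop (vm_class (lower (axis 1 1) :: 'a vmat)) = 3"
    proof -
      have "loop_ord paige_loop (vm_class (vm_neg (lower (axis 1 1)) :: 'a vmat)) = 3"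
        unfolding lower_def vm_neg.simps
        by (rule loop_ord_3) (use m1 in \<open>simp_all add: axis0 dot0\<close>)
      then show ?thesis by simp
    qed
    have ordw: "loop_ord paige_loop (vm_class ?w) = 3"
      by (rule loop_ord_3) (simp_all add: axis axis0)
    show ?thesis unfolding assms(3)
    proof (rule generating_tripleI[OF _ _ _ ordU ordL ordw])
      fix K :: "'a vmat set" and M :: "'a vmat"
      assume K: "vm_closed K" "upper (axis 1 1) \<in> K" "lower (axis 1 1) \<in> K" "?w \<in> K"
        and M: "vm_det M = 1"
      then show "M \<in> K"
        using vm_closed.all_if_card_3[OF K(1) card K(2-4) M] by blast
    qed (simp_all add: upper_def lower_def axis axis0 dot0 vm_class_eq_iff)
  next
    case large
    then have char: "(2::'a) \<noteq> 0"
      using assms(1) by (intro two_neq_0_if_odd_card) simp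
    obtain \<omega> :: 'a where \<omega>: "\<omega> \<noteq> 0" and prim: "\<And>t. t \<noteq> 0 \<Longrightarrow> \<exists>k::nat. t = \<omega> ^ k"
      using ex_primitive_element by blast
    \<comment> \<open>Here the field must have more than three elements, so that the torus is not just \<open>\<plusminus> 1\<close>.\<close>
    have sq: "\<omega>\<^sup>2 \<noteq> 1"
    proof
      assume 1: "\<omega>\<^sup>2 = 1"
      have "\<omega> ^ k \<in> {1, \<omega>}" for k
        by (induction k) (use 1 in \<open>auto simp: power2_eq_square\<close>)
      then have "UNIV \<subseteq> {0, 1, \<omega>}"
        using prim by fastforce
      then have "CARD('a) \<le> card {0, 1, \<omega>}"
        by (intro card_mono) auto
      also have "\<dots> \<le> 3"
        by (simp add: card_insert_if)
      finally have "q \<le> 3" using assms(1) by simp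
      then have "q = 0 \<or> q = 1 \<or> q = 2 \<or> q = 3" by linarith
      with large show False by auto
    qed
    then have "\<omega> \<noteq> 1" "\<omega> + 1 \<noteq> 0"
      by (auto simp: add_eq_0_iff2)
    define b where "b = 1 / (\<omega> + 1)"
    define a where "a = \<omega> * b"
    have tr: "a + b = 1"
      using \<open>\<omega> + 1 \<noteq> 0\<close> by (simp add: a_def b_def field_simps)
    then have b: "b = 1 - a" by (simp add: algebra_simps)
    define \<alpha> :: "'a ^ 3" where "\<alpha> = vector [1, 0, 1]"
    define \<beta> :: "'a ^ 3" where "\<beta> = vector [a * (1 - a), 1 - 2 * a, - 1]"
    let ?x = "VMat a \<alpha> \<beta> b"
    let ?y = "VMat a (- (1 / \<omega>) *s \<alpha>) (- \<omega> *s \<beta>) b"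
    let ?z = "VMat 1 (axis 1 1) (axis 1 (-1)) 0 :: 'a vmat"
    have dot: "dot \<alpha> \<beta> = a * b - 1"
      by (simp add: \<alpha>_def \<beta>_def vm_simps b)
    then have dot': "dot (- (1 / \<omega>) *s \<alpha>) (- \<omega> *s \<beta>) = a * b - 1"
      using \<omega> by (simp add: dot_def mult.assoc mult.left_commute)
    have \<alpha>3: "\<alpha> $ 3 = 1" by (simp add: \<alpha>_def vector_3)
    then have \<alpha>0: "\<alpha> \<noteq> 0" "- (1 / \<omega>) *s \<alpha> \<noteq> 0"
      using \<omega> by (auto simp: vec_eq_iff intro!: exI[of _ 3])
    have ax3: "axis (1::3) c $ 3 = (0::'a)" for c
      by (simp add: axis_def)
    show ?thesis unfolding assms(3)
    proof (rule generating_tripleI[of ?x ?y ?z])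
      show "loop_ord paige_loop (vm_class ?x) = 3"
        by (rule loop_ord_3) (use dot tr \<alpha>0 in auto)
      show "loop_ord paige_loop (vm_class ?y) = 3"
        by (rule loop_ord_3) (use dot' tr \<alpha>0 in auto)
      show "loop_ord paige_loop (vm_class ?z) = 3"
        by (rule loop_ord_3) (simp_all add: axis axis0)
      show "vm_class ?x \<noteq> vm_class ?y"
      proof
        assume "vm_class ?x = vm_class ?y"
        then have "\<alpha> $ 3 = (- (1 / \<omega>) *s \<alpha>) $ 3 \<or> \<alpha> $ 3 = (- (- (1 / \<omega>) *s \<alpha>)) $ 3"
          by (auto simp only: vm_class_eq_iff vm_neg.simps vmat.inject)
        then show False
          using \<alpha>3 \<omega> \<open>\<omega> \<noteq> 1\<close> \<open>\<omega> + 1 \<noteq> 0\<close> by (auto simp: field_simps eq_neg_iff_add_eq_0)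
      qed
      show "vm_class ?x \<noteq> vm_class ?z"
        using \<alpha>3 ax3 by (auto simp: vm_class_eq_iff)
      show "vm_class ?y \<noteq> vm_class ?z"
      proof
        assume "vm_class ?y = vm_class ?z"
        then have "(- (1 / \<omega>) *s \<alpha>) $ 3 = axis (1::3) 1 $ 3 \<or>
            (- (1 / \<omega>) *s \<alpha>) $ 3 = (- axis (1::3) 1) $ 3"
          by (auto simp only: vm_class_eq_iff vm_neg.simps vmat.inject)
        then show False using \<alpha>3 ax3 \<omega> by simp
      qed
    next
      fix K :: "'a vmat set" and M :: "'a vmat"
      assume K: "vm_closed K" "?x \<in> K" "?y \<in> K" "?z \<in> K" and M: "vm_det M = 1"
      have d: "VMat \<omega> 0 0 (1 / \<omega>) \<in> K"
        using vm_closed.mult[OF K(1-3)] diagonal_factor[OF \<omega> a_def tr dot] by simp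
      have x: "VMat a (vector [1, 0, 1]) (vector [a * (1 - a), 1 - 2 * a, - 1]) (1 - a) \<in> K"
        using K(2) by (simp add: \<alpha>_def \<beta>_def b)
      show "M \<in> K"
        by (rule vm_closed.all_if_torus[OF K(1) char \<omega> sq prim d K(4) x M])
    qed (use dot dot' axis in simp_all)
  qed
qed

end
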